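(* There exist two non-isomorphic $6$-regular graphs with girth $5$, diameter $4$ and order $6^2+6+2=44$, one with automorphism group of order $40$ and the other with automorphism group of order $240$.
   Context: Graphs are finite, simple and undirected. The order of a graph is its number of vertices; its diameter is the maximum distance between a pair of its vertices (so a graph of finite diameter is connected); its girth is the length of its smallest circuit. *)

theory Defs
  imports "Graph_Theory.Graph_Theory" "HOL-Algebra.Bij" "HOL-Algebra.Coset"
    "HOL-Library.Extended_Nat"
begin

text \<open>
  Finite simple undirected graphs are the \<^locale>\<open>pair_graph\<close>s of the library: finite, loop-free,
  symmetric digraphs whose arcs are pairs of vertices, an undirected edge being a pair of
  opposite arcs. In particular the out-degree is the usual degree.
\<close>

definition regular_graph :: "nat \<Rightarrow> 'a pair_pre_digraph \<Rightarrow> bool" where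
  "regular_graph k G \<longleftrightarrow> (\<forall>v \<in> pverts G. out_degree (with_proj G) v = k)"

text \<open>With unit weights \<^const>\<open>wf_digraph.\<mu>\<close> is the number of edges of a shortest walk, and
  \<open>\<infinity>\<close> between different components; a graph of finite diameter is therefore connected.\<close>

definition graph_dist :: "'a pair_pre_digraph \<Rightarrow> 'a \<Rightarrow> 'a \<Rightarrow> ereal" where
  "graph_dist G u v = wf_digraph.\<mu> (with_proj G) (\<lambda>_. 1) u v"

definition diameter :: "'a pair_pre_digraph \<Rightarrow> ereal" where
  "diameter G = (SUP u \<in> pverts G. SUP v \<in> pverts G. graph_dist G u v)"

text \<open>The bound \<open>3 \<le> length p\<close> discards the directed cycles that run through a single
  undirected edge back and forth. A graph without circuits has girth \<open>\<infinity>\<close>.\<close>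

definition girth :: "'a pair_pre_digraph \<Rightarrow> enat" where
  "girth G = (INF p \<in> {p. pre_digraph.cycle (with_proj G) p \<and> 3 \<le> length p}. enat (length p))"

text \<open>As in \<^const>\<open>AutoGroup\<close>, the elements of \<^const>\<open>Bij\<close> are extensional, i.e. \<open>undefined\<close> outside
  the vertex set, so that \<^const>\<open>order\<close> counts each automorphism once.\<close>

definition graph_automorphisms :: "'a pair_pre_digraph \<Rightarrow> ('a \<Rightarrow> 'a) set" where
  "graph_automorphisms G = {f \<in> Bij (pverts G).
     \<forall>u \<in> pverts G. \<forall>v \<in> pverts G. (f u, f v) \<in> parcs G \<longleftrightarrow> (u, v) \<in> parcs G}"

definition graph_aut_group :: "'a pair_pre_digraph \<Rightarrow> ('a \<Rightarrow> 'a) monoid" where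
  "graph_aut_group G = BijGroup (pverts G) \<lparr>carrier := graph_automorphisms G\<rparr>"

lemma subgroup_graph_automorphisms:
  "subgroup (graph_automorphisms G) (BijGroup (pverts G))"
proof (rule group.subgroupI[OF group_BijGroup])
  show "graph_automorphisms G \<subseteq> carrier (BijGroup (pverts G))"
    by (auto simp: graph_automorphisms_def BijGroup_def)
  have "(\<lambda>x \<in> pverts G. x) \<in> graph_automorphisms G"
    by (auto simp: graph_automorphisms_def id_Bij)
  then show "graph_automorphisms G \<noteq> {}" by blast
next
  fix f assume f: "f \<in> graph_automorphisms G"
  then have fB: "f \<in> Bij (pverts G)" by (simp add: graph_automorphisms_def)
  then have bij: "bij_betw f (pverts G) (pverts G)" by (simp add: Bij_def)
  let ?g = "restrict (inv_into (pverts G) f) (pverts G)"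
  have "(?g u, ?g v) \<in> parcs G \<longleftrightarrow> (u, v) \<in> parcs G"
    if "u \<in> pverts G" "v \<in> pverts G" for u v
  proof -
    let ?i = "inv_into (pverts G) f"
    have V: "?i u \<in> pverts G" "?i v \<in> pverts G"
      using bij_betw_apply[OF bij_betw_inv_into[OF bij]] that by blast+
    then have "(f (?i u), f (?i v)) \<in> parcs G \<longleftrightarrow> (?i u, ?i v) \<in> parcs G"
      using f by (simp add: graph_automorphisms_def)
    then show ?thesis
      using that by (simp add: bij_betw_inv_into_right[OF bij])
  qed
  then show "inv\<^bsub>BijGroup (pverts G)\<^esub> f \<in> graph_automorphisms G"
    using restrict_inv_into_Bij[OF fB] inv_BijGroup[OF fB]
    by (simp add: graph_automorphisms_def)
next
  fix f g assume fg: "f \<in> graph_automorphisms G" "g \<in> graph_automorphisms G"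
  then have B: "f \<in> Bij (pverts G)" "g \<in> Bij (pverts G)"
    by (simp_all add: graph_automorphisms_def)
  have "(compose (pverts G) f g u, compose (pverts G) f g v) \<in> parcs G \<longleftrightarrow> (u, v) \<in> parcs G"
    if "u \<in> pverts G" "v \<in> pverts G" for u v
  proof -
    have "g u \<in> pverts G" "g v \<in> pverts G"
      using Bij_imp_funcset[OF B(2)] that by (auto dest: funcset_mem)
    with fg that show ?thesis by (simp add: graph_automorphisms_def compose_eq)
  qed
  with B show "f \<otimes>\<^bsub>BijGroup (pverts G)\<^esub> g \<in> graph_automorphisms G"
    by (simp add: graph_automorphisms_def BijGroup_def compose_Bij)
qed

lemma group_graph_aut_group: "group (graph_aut_group G)"
  unfolding graph_aut_group_def
  by (rule subgroup.subgroup_is_group[OF subgroup_graph_automorphisms group_BijGroup])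

text \<open>Between graphs given by arc pairs, \<^const>\<open>digraph_iso\<close> is the usual notion.\<close>

lemma digraph_iso_pair_iff:
  assumes "pair_wf_digraph G" "pair_wf_digraph H"
  shows "digraph_iso (with_proj G) (with_proj H) \<longleftrightarrow>
    (\<exists>f. bij_betw f (pverts G) (pverts H) \<and>
      (\<forall>u \<in> pverts G. \<forall>v \<in> pverts G. (f u, f v) \<in> parcs H \<longleftrightarrow> (u, v) \<in> parcs G))"
    (is "?L \<longleftrightarrow> ?R")
proof
  assume ?L
  then obtain h where h: "pre_digraph.digraph_isomorphism (with_proj G) h"
    and H: "with_proj H = app_iso h (with_proj G)" unfolding digraph_iso_def by blast
  let ?f = "iso_verts h"
  have V: "pverts H = ?f ` pverts G" and A: "parcs H = iso_arcs h ` parcs G"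
    and T: "iso_tail h = fst" and D: "iso_head h = snd"
    using H by (auto simp: with_proj_def app_iso_def)
  have inj: "inj_on ?f (pverts G)"
    and arcs: "\<And>a. a \<in> parcs G \<Longrightarrow> iso_arcs h a = (?f (fst a), ?f (snd a))"
    using h T D by (auto simp: pre_digraph.digraph_isomorphism_def prod_eq_iff)
  have A': "parcs H = (\<lambda>(u, v). (?f u, ?f v)) ` parcs G"
    unfolding A using arcs by (force simp: image_iff)
  have "(?f u, ?f v) \<in> parcs H \<longleftrightarrow> (u, v) \<in> parcs G" if "u \<in> pverts G" "v \<in> pverts G" for u v
    using that inj pair_wf_digraph.in_arcsD1[OF assms(1)] pair_wf_digraph.in_arcsD2[OF assms(1)]
    unfolding A' by (fastforce simp: inj_on_eq_iff)
  with inj V show ?R by (auto simp: bij_betw_def)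
next
  assume ?R
  then obtain f where inj: "inj_on f (pverts G)" and V: "pverts H = f ` pverts G"
    and arcs: "\<And>u v. u \<in> pverts G \<Longrightarrow> v \<in> pverts G \<Longrightarrow> (f u, f v) \<in> parcs H \<longleftrightarrow> (u, v) \<in> parcs G"
    by (auto simp: bij_betw_def)
  note G = pair_wf_digraph.in_arcsD1[OF assms(1)] pair_wf_digraph.in_arcsD2[OF assms(1)]
  note H = pair_wf_digraph.in_arcsD1[OF assms(2)] pair_wf_digraph.in_arcsD2[OF assms(2)]
  let ?h = "\<lparr>iso_verts = f, iso_arcs = map_prod f f, iso_head = snd, iso_tail = fst\<rparr>"
  have "parcs H = map_prod f f ` parcs G"
  proof (intro equalityI subsetI)
    fix a assume a: "a \<in> parcs H"
    then obtain u v where "a = (f u, f v)" "u \<in> pverts G" "v \<in> pverts G"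
      using H V by (cases a) blast
    with a arcs show "a \<in> map_prod f f ` parcs G" by force
  next
    fix a assume "a \<in> map_prod f f ` parcs G"
    then show "a \<in> parcs H" using arcs G by auto
  qed
  then have "with_proj H = app_iso ?h (with_proj G)"
    using V by (simp add: with_proj_def app_iso_def)
  moreover have "pre_digraph.digraph_isomorphism (with_proj G) ?h"
  proof -
    have "wf_digraph (with_proj G)"
      using assms(1) G by (simp add: wf_digraph_def)
    moreover have "inj_on (map_prod f f) (parcs G)"
      using inj G by (auto simp: inj_on_def)
    ultimately show ?thesis using inj by (simp add: pre_digraph.digraph_isomorphism_def)
  qed
  ultimately show ?L unfolding digraph_iso_def by blast
qed

end

theory Submission
  imports Defs
begin

text \<open>
  Both graphs live on the projective line over the field with five elements. Their vertices are the
  30 ordered pairs of distinct points, six vertices \<open>i6\<close> that collect the pairs with first point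
  \<open>i\<close>, six vertices \<open>6j\<close> that collect five pairs each, and two centres \<open>76\<close> and \<open>67\<close> joined to the \<open>i6\<close>
  and to the \<open>6j\<close>. Two pairs are adjacent when their cross-ratio is 3. In the graph \<open>straight\<close>
  the vertex \<open>6j\<close> collects the pairs with second point \<open>j\<close>; then the projective group of order 120 and
  the interchange of the two coordinates act, which gives 240 automorphisms. In the graph
  \<open>twisted\<close> a pair of finite points belongs to \<open>6m\<close> for their midpoint \<open>m\<close> instead, and only the 20 affine
  maps survive from the projective group; together with one further involution
  (\<open>reflect\<close>) they give 40.

  Regularity and the absence of triangles and 4-cycles are read off the adjacency lists. The diameter
  needs no distance computation: in a \<open>k\<close>-regular graph of girth at least 5 a ball of radius 2 has
  \<open>k\<^sup>2 + 1\<close> vertices, so at order \<open>k\<^sup>2 + k + 2\<close> its complement is only as large as a closed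
  neighbourhood. Hence no distance exceeds 4 (\<open>awalk_le_4\<close>), and a vertex has at most one antipode, that is,
  vertex at distance 4 (\<open>antipode_unique\<close>).

  The automorphisms are counted by the orbit-stabilizer theorem along a chain of base points
  (\<open>orbit_stabilizer\<close>). Explicit automorphisms bound the orbits from below. From above they are bounded
  by invariants: having an antipode, and in the twisted graph also the existence of a certain
  6-cycle (\<open>hexagon\<close>). The chain ends in the trivial group because an automorphism that fixes two vertices also
  fixes their common neighbour and their antipodes (\<open>fixes_common_neighbour\<close>,
  \<open>fixes_antipode\<close>), and by these two rules the base points generate all vertices. Finally the
  graphs are not isomorphic since 14 vertices of the first have an antipode, but only 4 of the second.
\<close>

section \<open>Regular graphs of girth at least 5 and order \<open>k\<^sup>2 + k + 2\<close>\<close>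

text \<open>\<open>near\<close> is distance at most 2. Two vertices are \<open>antipodal\<close> when their distance is at least 4; this
  is said without walks, by keeping \<open>w\<close> and all its neighbours out of the ball of radius 2 about
  \<open>u\<close>, so that it can be decided from adjacency lists.\<close>

definition near :: "'a pair_pre_digraph \<Rightarrow> 'a \<Rightarrow> 'a \<Rightarrow> bool" where
  "near G u v \<longleftrightarrow> v = u \<or> (u, v) \<in> parcs G \<or> (\<exists>x. (u, x) \<in> parcs G \<and> (x, v) \<in> parcs G)"

definition antipodal :: "'a pair_pre_digraph \<Rightarrow> 'a \<Rightarrow> 'a \<Rightarrow> bool" where
  "antipodal G u w \<longleftrightarrow> u \<in> pverts G \<and> w \<in> pverts G \<and>
     \<not> near G u w \<and> (\<forall>x. (w, x) \<in> parcs G \<longrightarrow> \<not> near G u x)"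

abbreviation nbhd :: "'a pair_pre_digraph \<Rightarrow> 'a \<Rightarrow> 'a set" where
  "nbhd G u \<equiv> {v. (u, v) \<in> parcs G}"

text \<open>The order \<open>k\<^sup>2 + k + 2\<close> exceeds the number \<open>k\<^sup>2 + 1\<close> of vertices of a ball of radius 2 by
  \<open>k + 1\<close>, which is the size of a closed neighbourhood. This coincidence is what makes the
  antipodal pairs rigid below. The last two assumptions say that the girth is at least 5.\<close>

locale girth5_graph = pair_graph G for G :: "'a pair_pre_digraph" +
  fixes k :: nat
  assumes k_ge: "2 \<le> k"
    and card_nbhd: "u \<in> pverts G \<Longrightarrow> card (nbhd G u) = k"
    and card_verts: "card (pverts G) = k\<^sup>2 + k + 2"
    and no_triangle: "\<lbrakk>(u, v) \<in> parcs G; (v, w) \<in> parcs G\<rbrakk> \<Longrightarrow> (w, u) \<notin> parcs G"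
    and no_square: "\<lbrakk>(u, x) \<in> parcs G; (x, v) \<in> parcs G; (u, y) \<in> parcs G; (y, v) \<in> parcs G; u \<noteq> v\<rbrakk>
      \<Longrightarrow> x = y"
begin

lemma arc_sym: "(u, v) \<in> parcs G \<Longrightarrow> (v, u) \<in> parcs G"
  using pair_sym_arcs by (auto simp: symmetric_def dest: symD)

lemma no_loop: "(u, u) \<notin> parcs G"
  using pair_no_loops by force

lemma finite_nbhd: "finite (nbhd G u)"
  by (rule finite_subset[OF _ pair_finite_verts]) (auto dest: in_arcsD2)

lemma regular: "regular_graph k G"
  unfolding regular_graph_def
proof
  fix v assume v: "v \<in> pverts G"
  have "out_arcs (with_proj G) v = Pair v ` nbhd G v"
    by (auto simp: out_arcs_def)
  then show "out_degree (with_proj G) v = k"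
    using card_nbhd[OF v] by (simp add: out_degree_def card_image inj_on_def)
qed

lemma girth_eq_5:
  assumes "(a, b) \<in> parcs G" "(b, c) \<in> parcs G" "(c, d) \<in> parcs G" "(d, e) \<in> parcs G" "(e, a) \<in> parcs G"
    and "distinct [a, b, c, d, e]"
  shows "girth G = 5"
proof (rule antisym)
  have "cycle [(a, b), (b, c), (c, d), (d, e), (e, a)]"
    unfolding cycle_def using assms by (auto simp: awalk_def dest: in_arcsD1)
  then have "girth G \<le> enat (length [(a, b), (b, c), (c, d), (d, e), (e, a)])"
    unfolding girth_def by (intro INF_lower) simp
  then show "girth G \<le> 5" by (simp add: numeral_eq_enat eval_nat_numeral)
next
  have "5 \<le> length p" if p: "cycle p" "3 \<le> length p" for p
  proof (rule ccontr)
    assume "\<not> 5 \<le> length p"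
    then consider "length p = 3" | "length p = 4" using p(2) by linarith
    then show False
    proof cases
      case 1
      then obtain a a' b b' c c' where "p = [(a, a'), (b, b'), (c, c')]"
        by (auto simp: numeral_eq_Suc length_Suc_conv)
      with p(1) show False using no_triangle unfolding cycle_def
        by (auto simp: awalk_def)
    next
      case 2
      then obtain a a' b b' c c' d d' where "p = [(a, a'), (b, b'), (c, c'), (d, d')]"
        by (auto simp: numeral_eq_Suc length_Suc_conv)
      with p(1) have "(a, b) \<in> parcs G" "(b, c) \<in> parcs G" "(c, d) \<in> parcs G" "(d, a) \<in> parcs G"
        "a \<noteq> c" "b \<noteq> d"
        unfolding cycle_def by (auto simp: awalk_def)
      then show False using no_square[of a b c d] arc_sym by blast
    qed
  qed
  then show "5 \<le> girth G"
    unfolding girth_def by (intro INF_greatest) (auto simp: numeral_eq_enat)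
qed

lemma card_near:
  assumes u: "u \<in> pverts G"
  shows "card {v. near G u v} = k\<^sup>2 + 1"
proof -
  let ?S = "\<Union>x\<in>nbhd G u. nbhd G x - {u}"
  have "card ?S = (\<Sum>x\<in>nbhd G u. card (nbhd G x - {u}))"
    using finite_nbhd no_square by (intro card_UN_disjoint) blast+
  also have "\<dots> = (\<Sum>x\<in>nbhd G u. k - 1)"
  proof (rule sum.cong[OF refl])
    fix x assume "x \<in> nbhd G u"
    then have "u \<in> nbhd G x" "x \<in> pverts G" using arc_sym[of u x] in_arcsD2[of u x] by simp_all
    then show "card (nbhd G x - {u}) = k - 1" by (simp add: card_nbhd card_Diff_singleton)
  qed
  also have "\<dots> = k * (k - 1)"
    using card_nbhd[OF u] by simp
  finally have S: "card ?S = k * (k - 1)" .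
  have fin: "finite ?S" using finite_nbhd by blast
  have "{v. near G u v} = insert u (nbhd G u \<union> ?S)"
    unfolding near_def by blast
  moreover have "u \<notin> nbhd G u \<union> ?S" using no_loop by blast
  moreover have "nbhd G u \<inter> ?S = {}" using no_triangle arc_sym by blast
  ultimately have "card {v. near G u v} = Suc (k + k * (k - 1))"
    using S fin finite_nbhd card_nbhd[OF u] by (simp add: card_Un_disjoint)
  then show ?thesis
    using k_ge by (cases k) (auto simp: power2_eq_square)
qed

lemma near_in_verts: "u \<in> pverts G \<Longrightarrow> near G u v \<Longrightarrow> v \<in> pverts G"
  unfolding near_def by (auto dest: in_arcsD2)

text \<open>The closed neighbourhood of a vertex antipodal to \<open>u\<close> misses the ball of radius 2 about \<open>u\<close>,
  and both sides have \<open>k + 1\<close> elements.\<close>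

lemma closed_nbhd_antipode:
  assumes "antipodal G u w"
  shows "insert w (nbhd G w) = pverts G - {v. near G u v}"
proof (rule card_subset_eq)
  have u: "u \<in> pverts G" and w: "w \<in> pverts G" using assms by (auto simp: antipodal_def)
  show "insert w (nbhd G w) \<subseteq> pverts G - {v. near G u v}"
    using assms by (auto simp: antipodal_def dest: in_arcsD2)
  have "card (pverts G - {v. near G u v}) = k + 1"
    using near_in_verts[OF u] card_near[OF u] card_verts
    by (subst card_Diff_subset) (auto intro: finite_subset[OF _ pair_finite_verts])
  then show "card (insert w (nbhd G w)) = card (pverts G - {v. near G u v})"
    using card_nbhd[OF w] no_loop finite_nbhd by simp
qed (simp add: pair_finite_verts)

lemma nbhd_other:
  assumes "(v, w) \<in> parcs G"
  obtains y where "(v, y) \<in> parcs G" "y \<noteq> w"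
proof -
  have "nbhd G v \<noteq> {w}"
    using card_nbhd[OF in_arcsD1[OF assms]] k_ge by auto
  with assms that show thesis by blast
qed

text \<open>Two antipodes of the same vertex have equal closed neighbourhoods, so a second neighbour
  would close a triangle with them.\<close>

lemma antipode_unique:
  assumes "antipodal G u w" "antipodal G u w'"
  shows "w = w'"
proof (rule ccontr)
  assume ne: "w \<noteq> w'"
  have eq: "insert w (nbhd G w) = insert w' (nbhd G w')"
    using closed_nbhd_antipode[OF assms(1)] closed_nbhd_antipode[OF assms(2)] by simp
  have "w' \<in> insert w (nbhd G w)" unfolding eq by simp
  with ne have ww': "(w, w') \<in> parcs G" by simp
  then obtain y where y: "(w, y) \<in> parcs G" "y \<noteq> w'" by (rule nbhd_other)
  then have "y \<in> insert w' (nbhd G w')" unfolding eq[symmetric] by simp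
  with y(2) have "(w', y) \<in> parcs G" by simp
  with ww' have "(y, w) \<notin> parcs G" by (rule no_triangle)
  with arc_sym[OF y(1)] show False by contradiction
qed

lemma near_awalk:
  assumes "u \<in> pverts G" "near G u v"
  obtains p where "awalk u p v" "length p \<le> 2"
proof -
  consider "v = u" | "(u, v) \<in> parcs G" | x where "(u, x) \<in> parcs G" "(x, v) \<in> parcs G"
    using assms(2) unfolding near_def by blast
  then show thesis
  proof cases
    case 1 then show thesis using assms(1) by (intro that[of "[]"]) (auto simp: awalk_def)
  next
    case 2 then show thesis using assms(1) by (intro that[of "[(u, v)]"]) (auto simp: awalk_def)
  next
    case 3 then show thesis using assms(1)
      by (intro that[of "[(u, x), (x, v)]"]) (auto simp: awalk_def)
  qed
qed

text \<open>A vertex \<open>w\<close> at distance more than 3 from \<open>u\<close> has as closed neighbourhood the whole complement of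
  the ball of radius 2. A neighbour \<open>x\<close> of \<open>w\<close> has a further neighbour \<open>y\<close>, which is not adjacent
  to \<open>w\<close> for lack of triangles, hence lies in the ball; the walk from \<open>u\<close> to \<open>y\<close> continues
  through \<open>x\<close> to \<open>w\<close>.\<close>

lemma awalk_le_4:
  assumes u: "u \<in> pverts G" and w: "w \<in> pverts G"
  obtains p where "awalk u p w" "length p \<le> 4"
proof (cases "antipodal G u w")
  case False
  with u w consider "near G u w" | x where "(w, x) \<in> parcs G" "near G u x"
    unfolding antipodal_def by blast
  then show thesis
  proof cases
    case 1
    then obtain p where "awalk u p w" "length p \<le> 2" by (rule near_awalk[OF u])
    then show thesis by (intro that) auto
  next
    case 2
    obtain p where p: "awalk u p x" "length p \<le> 2" by (rule near_awalk[OF u 2(2)])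
    have "awalk x [(x, w)] w" using arc_sym[OF 2(1)] by (auto simp: awalk_def dest: in_arcsD1)
    then have "awalk u (p @ [(x, w)]) w" by (rule awalk_appendI[OF p(1)])
    moreover have "length (p @ [(x, w)]) \<le> 4" using p(2) by simp
    ultimately show thesis by (rule that)
  qed
next
  case True
  have "nbhd G w \<noteq> {}" using card_nbhd[OF w] k_ge by (intro notI) (simp del: Collect_empty_eq)
  then obtain x where x: "(w, x) \<in> parcs G" by blast
  obtain y where y: "(x, y) \<in> parcs G" "y \<noteq> w" using nbhd_other[OF arc_sym[OF x]] .
  have "y \<notin> insert w (nbhd G w)"
    using y no_triangle[OF x y(1)] arc_sym[of w y] by blast
  with closed_nbhd_antipode[OF True] have "near G u y"
    using in_arcsD2[OF y(1)] by blast
  then obtain p where p: "awalk u p y" "length p \<le> 2" by (rule near_awalk[OF u])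
  have "awalk y [(y, x), (x, w)] w"
    using arc_sym[OF x] arc_sym[OF y(1)] in_arcsD2[OF y(1)] by (auto simp: awalk_def)
  then have "awalk u (p @ [(y, x), (x, w)]) w" by (rule awalk_appendI[OF p(1)])
  moreover have "length (p @ [(y, x), (x, w)]) \<le> 4" using p(2) by simp
  ultimately show thesis by (rule that)
qed

lemma antipodal_awalk_ge_4:
  assumes "antipodal G u w" "awalk u p w"
  shows "4 \<le> length p"
proof (rule ccontr)
  assume "\<not> 4 \<le> length p"
  then consider "p = []" | a b where "p = [(a, b)]" | a b c d where "p = [(a, b), (c, d)]"
    | a b c d e f where "p = [(a, b), (c, d), (e, f)]"
    by (cases p rule: remdups_adj.cases; cases "tl (tl p)"; cases "tl (tl (tl p))") auto
  then have "near G u w \<or> (\<exists>x. (x, w) \<in> parcs G \<and> near G u x)"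
  proof cases
    case 4
    with assms(2) have "(u, c) \<in> parcs G" "(c, e) \<in> parcs G" "(e, w) \<in> parcs G"
      by (auto simp: awalk_def)
    then show ?thesis unfolding near_def by blast
  qed (use assms(2) in \<open>auto simp: awalk_def near_def\<close>)
  with assms(1) arc_sym show False unfolding antipodal_def by blast
qed

lemma graph_dist_eq: "graph_dist G u v = (INF p \<in> {p. awalk u p v}. ereal (length p))"
proof -
  have "awalk_cost (\<lambda>_. 1) p = real (length p)" for p
    by (induction p) simp_all
  then show ?thesis unfolding graph_dist_def \<mu>_def by simp
qed

lemma diameter_eq_4:
  assumes "antipodal G u w"
  shows "diameter G = 4"
proof (rule antisym)
  have "graph_dist G x y \<le> 4" if xy: "x \<in> pverts G" "y \<in> pverts G" for x y
  proof -
    obtain p where "awalk x p y" "length p \<le> 4" by (rule awalk_le_4[OF xy])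
    then show ?thesis unfolding graph_dist_eq by (intro INF_lower2[of p]) auto
  qed
  then show "diameter G \<le> 4" unfolding diameter_def by (intro SUP_least)
  have "4 \<le> graph_dist G u w"
    unfolding graph_dist_eq using antipodal_awalk_ge_4[OF assms] by (intro INF_greatest) force
  then show "4 \<le> diameter G"
    using assms unfolding diameter_def antipodal_def by (blast intro: SUP_upper2)
qed

end

section \<open>Isomorphisms and antipodes\<close>

lemma near_iso_iff:
  assumes "pair_wf_digraph G" "pair_wf_digraph H" and f: "bij_betw f (pverts G) (pverts H)"
    and arcs: "\<forall>u\<in>pverts G. \<forall>v\<in>pverts G. (f u, f v) \<in> parcs H \<longleftrightarrow> (u, v) \<in> parcs G"
    and u: "u \<in> pverts G" and v: "v \<in> pverts G"
  shows "near H (f u) (f v) \<longleftrightarrow> near G u v"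
proof -
  have V: "pverts H = f ` pverts G" and inj: "inj_on f (pverts G)"
    using f by (auto simp: bij_betw_def)
  have "f v = f u \<longleftrightarrow> v = u" using inj u v by (simp add: inj_on_eq_iff)
  moreover have "(f u, f v) \<in> parcs H \<longleftrightarrow> (u, v) \<in> parcs G" using arcs u v by blast
  moreover have "(\<exists>x. (f u, x) \<in> parcs H \<and> (x, f v) \<in> parcs H) \<longleftrightarrow>
    (\<exists>x. (u, x) \<in> parcs G \<and> (x, v) \<in> parcs G)" (is "?L \<longleftrightarrow> ?R")
  proof
    assume ?L
    then obtain x where x: "(f u, x) \<in> parcs H" "(x, f v) \<in> parcs H" by blast
    then obtain y where "x = f y" "y \<in> pverts G"
      using pair_wf_digraph.in_arcsD2[OF assms(2) x(1)] V by blast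
    with x arcs u v show ?R by blast
  next
    assume ?R
    then obtain x where x: "(u, x) \<in> parcs G" "(x, v) \<in> parcs G" by blast
    then have "x \<in> pverts G" using pair_wf_digraph.in_arcsD2[OF assms(1)] by blast
    with x arcs u v show ?L by blast
  qed
  ultimately show ?thesis unfolding near_def by simp
qed

lemma antipodal_iso_iff:
  assumes "pair_wf_digraph G" "pair_wf_digraph H" and f: "bij_betw f (pverts G) (pverts H)"
    and arcs: "\<forall>u\<in>pverts G. \<forall>v\<in>pverts G. (f u, f v) \<in> parcs H \<longleftrightarrow> (u, v) \<in> parcs G"
    and u: "u \<in> pverts G" and v: "v \<in> pverts G"
  shows "antipodal H (f u) (f v) \<longleftrightarrow> antipodal G u v"
proof -
  note nr = near_iso_iff[OF assms(1-4) u]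
  have V: "pverts H = f ` pverts G" using f by (auto simp: bij_betw_def)
  have "(\<exists>x. (f v, x) \<in> parcs H \<and> near H (f u) x) \<longleftrightarrow> (\<exists>x. (v, x) \<in> parcs G \<and> near G u x)"
    (is "?L \<longleftrightarrow> ?R")
  proof
    assume ?L
    then obtain x where x: "(f v, x) \<in> parcs H" "near H (f u) x" by blast
    then obtain y where "x = f y" "y \<in> pverts G"
      using pair_wf_digraph.in_arcsD2[OF assms(2) x(1)] V by blast
    with x arcs v nr show ?R by blast
  next
    assume ?R
    then obtain x where x: "(v, x) \<in> parcs G" "near G u x" by blast
    then have "x \<in> pverts G" using pair_wf_digraph.in_arcsD2[OF assms(1)] by blast
    with x arcs v nr show ?L by blast
  qed
  then show ?thesis
    using u v nr[OF v] V unfolding antipodal_def by blast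
qed

section \<open>Counting automorphisms along a base\<close>

definition pointwise_stabilizer :: "'a pair_pre_digraph \<Rightarrow> 'a set \<Rightarrow> ('a \<Rightarrow> 'a) set" where
  "pointwise_stabilizer G B = {f \<in> graph_automorphisms G. \<forall>b\<in>B. f b = b}"

lemma automorphismD:
  assumes "f \<in> graph_automorphisms G"
  shows "bij_betw f (pverts G) (pverts G)" "f \<in> extensional (pverts G)"
    "\<forall>u\<in>pverts G. \<forall>v\<in>pverts G. (f u, f v) \<in> parcs G \<longleftrightarrow> (u, v) \<in> parcs G"
  using assms by (auto simp: graph_automorphisms_def Bij_def)

lemma stabilizer_compose:
  assumes "f \<in> pointwise_stabilizer G B" "g \<in> pointwise_stabilizer G B" "B \<subseteq> pverts G"
  shows "compose (pverts G) f g \<in> pointwise_stabilizer G B"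
proof -
  have "f \<otimes>\<^bsub>BijGroup (pverts G)\<^esub> g \<in> graph_automorphisms G"
    using assms by (intro subgroup.m_closed[OF subgroup_graph_automorphisms]) (auto simp: pointwise_stabilizer_def)
  moreover have "f \<in> Bij (pverts G)" "g \<in> Bij (pverts G)"
    using assms by (auto simp: pointwise_stabilizer_def graph_automorphisms_def)
  ultimately show ?thesis
    using assms by (auto simp: BijGroup_def pointwise_stabilizer_def compose_eq subset_iff)
qed

lemma stabilizer_inverse:
  assumes f: "f \<in> pointwise_stabilizer G B" and B: "B \<subseteq> pverts G"
  shows "restrict (inv_into (pverts G) f) (pverts G) \<in> pointwise_stabilizer G B"
proof -
  have fB: "f \<in> Bij (pverts G)" using f by (auto simp: pointwise_stabilizer_def graph_automorphisms_def)
  then have "inj_on f (pverts G)" by (auto simp: Bij_def bij_betw_def)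
  then have "inv_into (pverts G) f (f b) = b" if "b \<in> B" for b
    using B that by (auto intro: inv_into_f_f)
  then have "inv_into (pverts G) f b = b" if "b \<in> B" for b
    using f that by (auto simp: pointwise_stabilizer_def)
  moreover have "inv\<^bsub>BijGroup (pverts G)\<^esub> f \<in> graph_automorphisms G"
    using f by (intro subgroup.m_inv_closed[OF subgroup_graph_automorphisms]) (auto simp: pointwise_stabilizer_def)
  ultimately show ?thesis
    using fB B by (auto simp: inv_BijGroup pointwise_stabilizer_def)
qed

lemma finite_automorphisms:
  assumes "finite (pverts G)"
  shows "finite (graph_automorphisms G)"
proof (rule finite_subset)
  show "graph_automorphisms G \<subseteq> pverts G \<rightarrow>\<^sub>E pverts G"
    by (auto simp: graph_automorphisms_def PiE_def Bij_def bij_betw_def)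
  show "finite (pverts G \<rightarrow>\<^sub>E pverts G)" using assms by (simp add: finite_PiE)
qed

text \<open>Each fibre of \<open>f \<mapsto> f x\<close> is a left coset of the stabilizer of \<open>x\<close>. Iterated along a list of base
  points with trivial common stabilizer, this yields the order of the group as a product of orbit
  sizes.\<close>

lemma orbit_stabilizer:
  assumes fin: "finite (pverts G)" and x: "x \<in> pverts G" and B: "B \<subseteq> pverts G"
  shows "card (pointwise_stabilizer G B) = card ((\<lambda>f. f x) ` pointwise_stabilizer G B) * card (pointwise_stabilizer G (insert x B))"
proof -
  let ?V = "pverts G" and ?S = "pointwise_stabilizer G B"
  have finS: "finite ?S"
    using finite_automorphisms[OF fin] by (simp add: pointwise_stabilizer_def)
  have fiber: "card {f \<in> ?S. f x = y} = card (pointwise_stabilizer G (insert x B))" if y: "y \<in> (\<lambda>f. f x) ` ?S" for y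
  proof -
    obtain g where g: "g \<in> ?S" "g x = y" using y by blast
    let ?g' = "restrict (inv_into ?V g) ?V"
    have g': "?g' \<in> ?S" by (rule stabilizer_inverse[OF g(1) B])
    have bij: "bij_betw g ?V ?V" using g(1) by (auto simp: pointwise_stabilizer_def dest: automorphismD(1))
    have ext: "f \<in> extensional ?V" "f \<in> ?V \<rightarrow> ?V" if "f \<in> ?S" for f
      using that by (auto simp: pointwise_stabilizer_def dest: automorphismD(2) bij_betw_apply[OF automorphismD(1)])
    have gg: "inv_into ?V g (g v) = v" "g (inv_into ?V g v) = v" if "v \<in> ?V" for v
      using bij that by (auto simp: bij_betw_inv_into_left bij_betw_inv_into_right)
    have "bij_betw (compose ?V g) (pointwise_stabilizer G (insert x B)) {f \<in> ?S. f x = y}"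
    proof (rule bij_betw_byWitness[where f' = "compose ?V ?g'"])
      show "\<forall>f\<in>pointwise_stabilizer G (insert x B). compose ?V ?g' (compose ?V g f) = f"
      proof
        fix f assume "f \<in> pointwise_stabilizer G (insert x B)"
        then have f: "f \<in> ?S" by (simp add: pointwise_stabilizer_def)
        show "compose ?V ?g' (compose ?V g f) = f"
          using ext[OF f] ext[OF g(1)] gg(1)
          by (intro extensionalityI[of _ ?V]) (auto simp: compose_def Pi_iff)
      qed
      show "\<forall>f\<in>{f \<in> ?S. f x = y}. compose ?V g (compose ?V ?g' f) = f"
      proof
        fix f assume "f \<in> {f \<in> ?S. f x = y}"
        then have f: "f \<in> ?S" by simp
        show "compose ?V g (compose ?V ?g' f) = f"
          using ext[OF f] ext(2)[OF g'] gg(2)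
          by (intro extensionalityI[of _ ?V]) (auto simp: compose_def Pi_iff)
      qed
      show "compose ?V g ` pointwise_stabilizer G (insert x B) \<subseteq> {f \<in> ?S. f x = y}"
        using stabilizer_compose[OF g(1) _ B] g(2) x by (auto simp: pointwise_stabilizer_def compose_eq)
      show "compose ?V ?g' ` {f \<in> ?S. f x = y} \<subseteq> pointwise_stabilizer G (insert x B)"
      proof
        fix h assume "h \<in> compose ?V ?g' ` {f \<in> ?S. f x = y}"
        then obtain f where f: "f \<in> ?S" "f x = y" "h = compose ?V ?g' f" by blast
        have "h \<in> ?S" unfolding f(3) by (rule stabilizer_compose[OF g' f(1) B])
        moreover have "y \<in> ?V" using ext(2)[OF f(1)] f(2) x by auto
        then have "h x = x" unfolding f(3) using gg(1)[OF x] g(2) f(2) x by (simp add: compose_eq)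
        ultimately show "h \<in> pointwise_stabilizer G (insert x B)" by (simp add: pointwise_stabilizer_def)
      qed
    qed
    then show ?thesis by (simp add: bij_betw_same_card)
  qed
  have "card ?S = (\<Sum>y\<in>(\<lambda>f. f x) ` ?S. card {f \<in> ?S. f x = y})"
  proof -
    have "?S = (\<Union>y\<in>(\<lambda>f. f x) ` ?S. {f \<in> ?S. f x = y})" by blast
    then have "card ?S = card (\<Union>y\<in>(\<lambda>f. f x) ` ?S. {f \<in> ?S. f x = y})" by (rule arg_cong)
    also have "\<dots> = (\<Sum>y\<in>(\<lambda>f. f x) ` ?S. card {f \<in> ?S. f x = y})"
      using finS by (intro card_UN_disjoint) auto
    finally show ?thesis .
  qed
  with fiber show ?thesis by simp
qed

text \<open>Orbits are bounded from below by applying explicit automorphisms repeatedly.\<close>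

lemma orbit_step:
  assumes "g \<in> pointwise_stabilizer G B" "B \<subseteq> pverts G" "x \<in> pverts G" "y \<in> (\<lambda>f. f x) ` pointwise_stabilizer G B"
  shows "g y \<in> (\<lambda>f. f x) ` pointwise_stabilizer G B"
proof -
  obtain f where f: "f \<in> pointwise_stabilizer G B" "y = f x" using assms(4) by blast
  then have "g y = compose (pverts G) g f x" using assms(3) by (simp add: compose_eq)
  then show ?thesis using stabilizer_compose[OF assms(1) f(1) assms(2)] by blast
qed

lemma base_in_orbit: "B \<subseteq> pverts G \<Longrightarrow> x \<in> pverts G \<Longrightarrow> x \<in> (\<lambda>f. f x) ` pointwise_stabilizer G B"
proof (rule image_eqI[where x = "\<lambda>v\<in>pverts G. v"])
  assume "B \<subseteq> pverts G"
  then show "(\<lambda>v\<in>pverts G. v) \<in> pointwise_stabilizer G B"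
    by (auto simp: pointwise_stabilizer_def graph_automorphisms_def id_Bij)
qed simp

lemma card_stabilizer_whole:
  assumes "B \<subseteq> pverts G" and "\<And>f v. f \<in> pointwise_stabilizer G B \<Longrightarrow> v \<in> pverts G \<Longrightarrow> f v = v"
  shows "card (pointwise_stabilizer G B) = 1"
proof -
  have "pointwise_stabilizer G B = {\<lambda>v\<in>pverts G. v}"
  proof (intro equalityI subsetI)
    fix f assume f: "f \<in> pointwise_stabilizer G B"
    then have "f = (\<lambda>v\<in>pverts G. v)"
      using assms(2)[OF f] automorphismD(2)[of f G]
      by (intro extensionalityI[of _ "pverts G"]) (auto simp: pointwise_stabilizer_def)
    then show "f \<in> {\<lambda>v\<in>pverts G. v}" by simp
  next
    fix f assume "f \<in> {\<lambda>v\<in>pverts G. v}"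
    then show "f \<in> pointwise_stabilizer G B"
      using assms(1) by (auto simp: pointwise_stabilizer_def graph_automorphisms_def id_Bij)
  qed
  then show ?thesis by simp
qed

lemma order_graph_aut_group: "order (graph_aut_group G) = card (pointwise_stabilizer G {})"
  by (simp add: order_def graph_aut_group_def pointwise_stabilizer_def)

context girth5_graph begin

text \<open>Without 4-cycles a vertex is determined by any two of its neighbours.\<close>

lemma fixes_common_neighbour:
  assumes f: "f \<in> graph_automorphisms G" and "f u = u" "f v = v" "u \<noteq> v"
    and w: "(w, u) \<in> parcs G" "(w, v) \<in> parcs G"
  shows "f w = w"
proof -
  have V: "u \<in> pverts G" "v \<in> pverts G" "w \<in> pverts G" using w by (auto dest: in_arcsD1 in_arcsD2)
  with w assms(2,3) have "(f w, u) \<in> parcs G" "(f w, v) \<in> parcs G"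
    using automorphismD(3)[OF f] by metis+
  with w \<open>u \<noteq> v\<close> show ?thesis
    using no_square[of u "f w" v w] arc_sym by blast
qed

lemma fixes_antipode:
  assumes f: "f \<in> graph_automorphisms G" and "antipodal G u w" "f u = u"
  shows "f w = w"
proof -
  have "u \<in> pverts G" "w \<in> pverts G" using assms(2) by (auto simp: antipodal_def)
  then have "antipodal G (f u) (f w)"
    using antipodal_iso_iff[OF pair_wf_digraph_axioms pair_wf_digraph_axioms automorphismD(1)[OF f] automorphismD(3)[OF f]]
      assms(2) by blast
  with assms show ?thesis using antipode_unique by metis
qed

end

section \<open>Two graphs on the projective line of order 5\<close>

text \<open>The points of the projective line over the field with five elements are \<open>0, \<dots>, 4\<close> and
  \<open>5\<close> for infinity. The number \<open>bracket a b\<close> is the determinant of the homogeneous coordinates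
  \<open>(a, 1)\<close>, \<open>(b, 1)\<close>, or \<open>(1, 0)\<close> for infinity.\<close>

definition bracket :: "nat \<Rightarrow> nat \<Rightarrow> int" where
  "bracket a b = (if a = 5 then (if b = 5 then 0 else 1) else if b = 5 then - 1 else int a - int b)"

definition point_pairs :: "(nat \<times> nat) list" where
  "point_pairs = [(i, j). i \<leftarrow> [0..<6], j \<leftarrow> [0..<6], i \<noteq> j]"

text \<open>A vertex is a number with two decimal digits. The number \<open>ij\<close> with \<open>i, j \<le> 5\<close> stands for an ordered
  pair of distinct points, and a digit \<open>6\<close> is a wildcard: \<open>i6\<close> and \<open>6j\<close> collect pairs that agree
  in one respect. The two remaining vertices \<open>76\<close> and \<open>67\<close> are the centres that
  collect the \<open>i6\<close> and the \<open>6j\<close>.\<close>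

definition vertex_list :: "nat list" where
  "vertex_list = [10 * i + j. (i, j) \<leftarrow> point_pairs] @
     map (\<lambda>i. 10 * i + 6) [0..<6] @ map (\<lambda>j. 60 + j) [0..<6] @ [67, 76]"

text \<open>The two graphs differ in the function \<open>t\<close>, which decides to which \<open>6j\<close> a pair belongs. Two pairs
  \<open>(i, j)\<close> and \<open>(k, l)\<close> are adjacent when their cross-ratio is 3.\<close>

definition nbrs :: "(nat \<Rightarrow> nat \<Rightarrow> nat) \<Rightarrow> nat \<Rightarrow> nat list" where
  "nbrs t v = (let i = v div 10; j = v mod 10 in
     if v = 76 then map (\<lambda>k. 10 * k + 6) [0..<6]
     else if v = 67 then map (\<lambda>k. 60 + k) [0..<6]
     else if j = 6 then 76 # [10 * k + l. (k, l) \<leftarrow> point_pairs, k = i]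
     else if i = 6 then 67 # [10 * k + l. (k, l) \<leftarrow> point_pairs, t k l = j]
     else (10 * i + 6) # (60 + t i j) #
       [10 * k + l. (k, l) \<leftarrow> point_pairs,
          (bracket i k * bracket j l) mod 5 = (3 * (bracket i l * bracket j k)) mod 5])"

text \<open>The factor 3 inverts 2 modulo 5. A pair with an infinite member keeps its second point.\<close>

definition midpoint :: "nat \<Rightarrow> nat \<Rightarrow> nat" where
  "midpoint i j = (if i = 5 \<or> j = 5 then j else (3 * (i + j)) mod 5)"

definition straight :: "nat \<Rightarrow> nat list" where
  "straight = nbrs (\<lambda>_ j. j)"

definition twisted :: "nat \<Rightarrow> nat list" where
  "twisted = nbrs midpoint"

definition list_graph :: "(nat \<Rightarrow> nat list) \<Rightarrow> nat pair_pre_digraph" where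
  "list_graph nb = \<lparr>pverts = set vertex_list, parcs = {(u, v). u \<in> set vertex_list \<and> v \<in> set (nb u)}\<rparr>"

lemma pverts_list_graph [simp]: "pverts (list_graph nb) = set vertex_list"
  and parcs_list_graph [simp]: "(u, v) \<in> parcs (list_graph nb) \<longleftrightarrow> u \<in> set vertex_list \<and> v \<in> set (nb u)"
  by (simp_all add: list_graph_def)

text \<open>A permutation of the points acts on both digits; the entries for the digits 6 and 7 keep the
  wildcard and the centres in place.\<close>

definition relabel :: "nat list \<Rightarrow> nat \<Rightarrow> nat" where
  "relabel \<pi> v = 10 * \<pi> ! (v div 10) + \<pi> ! (v mod 10)"

text \<open>The maps \<open>x \<mapsto> x + 1\<close>, \<open>x \<mapsto> 2 x\<close> and \<open>x \<mapsto> 1 / x\<close> generate the projective group, which preserves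
  cross-ratios. Only the first two preserve midpoints.\<close>

definition shift :: "nat \<Rightarrow> nat" where
  "shift = relabel [1, 2, 3, 4, 0, 5, 6, 7]"

definition dilate :: "nat \<Rightarrow> nat" where
  "dilate = relabel [0, 2, 4, 1, 3, 5, 6, 7]"

definition invert :: "nat \<Rightarrow> nat" where
  "invert = relabel [5, 1, 3, 2, 4, 0, 6, 7]"

text \<open>Interchanging the members of both pairs leaves the cross-ratio unchanged, so reversing the digits is
  an automorphism as long as \<open>6j\<close> collects by the second point.\<close>

definition reverse :: "nat \<Rightarrow> nat" where
  "reverse v = 10 * (v mod 10) + v div 10"

text \<open>An extra symmetry of the graph with midpoints: \<open>(i, j)\<close> goes to \<open>(2 j - i, j)\<close>, the reflection of
  \<open>i\<close> in \<open>j\<close>, when both points are finite (\<open>4 i\<close> is \<open>- i\<close> modulo 5). For finite \<open>j\<close> it exchanges \<open>5j\<close> with \<open>j6\<close>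
  and \<open>j5\<close> with \<open>6j\<close>, and accordingly the centre \<open>76\<close> with \<open>56\<close> and \<open>67\<close> with \<open>65\<close>.\<close>

definition reflect :: "nat \<Rightarrow> nat" where
  "reflect v = (let i = v div 10; j = v mod 10 in
     if v = 56 then 76 else if v = 76 then 56 else if v = 65 then 67 else if v = 67 then 65
     else if i = 5 then 10 * j + 6 else if j = 6 then 50 + i
     else if j = 5 then 60 + i else if i = 6 then 10 * j + 5
     else 10 * ((2 * j + 4 * i) mod 5) + j)"

section \<open>Adjacency lists and generators in explicit form\<close>

lemma vertex_list_eq: "vertex_list =
  [1, 2, 3, 4, 5, 10, 12, 13, 14, 15, 20, 21, 23, 24, 25, 30, 31, 32, 34, 35, 40, 41,
   42, 43, 45, 50, 51, 52, 53, 54, 6, 16, 26, 36, 46, 56, 60, 61, 62, 63, 64, 65, 67,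
   76]"
  by (simp add: vertex_list_def point_pairs_def upt_rec)

lemma straight_table: "map straight vertex_list =
  [[6, 61, 23, 34, 45, 52], [6, 62, 13, 35, 41, 54], [6, 63, 14, 25, 42, 51],
   [6, 64, 15, 21, 32, 53], [6, 65, 12, 24, 31, 43], [16, 60, 25, 32, 43, 54],
   [16, 62, 5, 34, 40, 53], [16, 63, 2, 24, 45, 50], [16, 64, 3, 20, 35, 52],
   [16, 65, 4, 23, 30, 42], [26, 60, 14, 31, 45, 53], [26, 61, 4, 35, 43, 50],
   [26, 63, 1, 15, 40, 54], [26, 64, 5, 13, 30, 51], [26, 65, 3, 10, 34, 41],
   [36, 60, 15, 24, 41, 52], [36, 61, 5, 20, 42, 54], [36, 62, 4, 10, 45, 51],
   [36, 64, 1, 12, 25, 50], [36, 65, 2, 14, 21, 40], [46, 60, 12, 23, 35, 51],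
   [46, 61, 2, 25, 30, 53], [46, 62, 3, 15, 31, 50], [46, 63, 5, 10, 21, 52],
   [46, 65, 1, 13, 20, 32], [56, 60, 13, 21, 34, 42], [56, 61, 3, 24, 32, 40],
   [56, 62, 1, 14, 30, 43], [56, 63, 4, 12, 20, 41], [56, 64, 2, 10, 23, 31],
   [76, 1, 2, 3, 4, 5], [76, 10, 12, 13, 14, 15], [76, 20, 21, 23, 24, 25],
   [76, 30, 31, 32, 34, 35], [76, 40, 41, 42, 43, 45], [76, 50, 51, 52, 53, 54],
   [67, 10, 20, 30, 40, 50], [67, 1, 21, 31, 41, 51], [67, 2, 12, 32, 42, 52],
   [67, 3, 13, 23, 43, 53], [67, 4, 14, 24, 34, 54], [67, 5, 15, 25, 35, 45],
   [60, 61, 62, 63, 64, 65], [6, 16, 26, 36, 46, 56]]"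
  by (simp add: vertex_list_eq straight_def nbrs_def point_pairs_def upt_rec bracket_def)

lemma twisted_table: "map twisted vertex_list =
  [[6, 63, 23, 34, 45, 52], [6, 61, 13, 35, 41, 54], [6, 64, 14, 25, 42, 51],
   [6, 62, 15, 21, 32, 53], [6, 65, 12, 24, 31, 43], [16, 63, 25, 32, 43, 54],
   [16, 64, 5, 34, 40, 53], [16, 62, 2, 24, 45, 50], [16, 60, 3, 20, 35, 52],
   [16, 65, 4, 23, 30, 42], [26, 61, 14, 31, 45, 53], [26, 64, 4, 35, 43, 50],
   [26, 60, 1, 15, 40, 54], [26, 63, 5, 13, 30, 51], [26, 65, 3, 10, 34, 41],
   [36, 64, 15, 24, 41, 52], [36, 62, 5, 20, 42, 54], [36, 60, 4, 10, 45, 51],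
   [36, 61, 1, 12, 25, 50], [36, 65, 2, 14, 21, 40], [46, 62, 12, 23, 35, 51],
   [46, 60, 2, 25, 30, 53], [46, 63, 3, 15, 31, 50], [46, 61, 5, 10, 21, 52],
   [46, 65, 1, 13, 20, 32], [56, 60, 13, 21, 34, 42], [56, 61, 3, 24, 32, 40],
   [56, 62, 1, 14, 30, 43], [56, 63, 4, 12, 20, 41], [56, 64, 2, 10, 23, 31],
   [76, 1, 2, 3, 4, 5], [76, 10, 12, 13, 14, 15], [76, 20, 21, 23, 24, 25],
   [76, 30, 31, 32, 34, 35], [76, 40, 41, 42, 43, 45], [76, 50, 51, 52, 53, 54],
   [67, 14, 23, 32, 41, 50], [67, 2, 20, 34, 43, 51], [67, 4, 13, 31, 40, 52],
   [67, 1, 10, 24, 42, 53], [67, 3, 12, 21, 30, 54], [67, 5, 15, 25, 35, 45],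
   [60, 61, 62, 63, 64, 65], [6, 16, 26, 36, 46, 56]]"
  by (simp add: vertex_list_eq twisted_def nbrs_def point_pairs_def upt_rec bracket_def midpoint_def)

lemmas straight_rows = straight_table[unfolded vertex_list_eq list.map list.inject simp_thms]
lemmas twisted_rows = twisted_table[unfolded vertex_list_eq list.map list.inject simp_thms]

lemma shift_table: "map shift vertex_list =
  [12, 13, 14, 10, 15, 21, 23, 24, 20, 25, 31, 32, 34, 30, 35, 41, 42, 43, 40, 45, 1,
   2, 3, 4, 5, 51, 52, 53, 54, 50, 16, 26, 36, 46, 6, 56, 61, 62, 63, 64, 60, 65, 67,
   76]"
  by (simp add: vertex_list_eq shift_def relabel_def)

lemmas shift_rows = shift_table[unfolded vertex_list_eq list.map list.inject simp_thms]

lemma dilate_table: "map dilate vertex_list =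
  [2, 4, 1, 3, 5, 20, 24, 21, 23, 25, 40, 42, 41, 43, 45, 10, 12, 14, 13, 15, 30, 32,
   34, 31, 35, 50, 52, 54, 51, 53, 6, 26, 46, 16, 36, 56, 60, 62, 64, 61, 63, 65, 67,
   76]"
  by (simp add: vertex_list_eq dilate_def relabel_def)

lemmas dilate_rows = dilate_table[unfolded vertex_list_eq list.map list.inject simp_thms]

lemma invert_table: "map invert vertex_list =
  [51, 53, 52, 54, 50, 15, 13, 12, 14, 10, 35, 31, 32, 34, 30, 25, 21, 23, 24, 20, 45,
   41, 43, 42, 40, 5, 1, 3, 2, 4, 56, 16, 36, 26, 46, 6, 65, 61, 63, 62, 64, 60, 67, 76]"
  by (simp add: vertex_list_eq invert_def relabel_def)

lemmas invert_rows = invert_table[unfolded vertex_list_eq list.map list.inject simp_thms]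

lemma reverse_table: "map reverse vertex_list =
  [10, 20, 30, 40, 50, 1, 21, 31, 41, 51, 2, 12, 32, 42, 52, 3, 13, 23, 43, 53, 4, 14,
   24, 34, 54, 5, 15, 25, 35, 45, 60, 61, 62, 63, 64, 65, 6, 16, 26, 36, 46, 56, 76, 67]"
  by (simp add: vertex_list_eq reverse_def)

lemmas reverse_rows = reverse_table[unfolded vertex_list_eq list.map list.inject simp_thms]

lemma reflect_table: "map reflect vertex_list =
  [21, 42, 13, 34, 60, 40, 32, 3, 24, 61, 30, 1, 43, 14, 62, 20, 41, 12, 4, 63, 10, 31,
   2, 23, 64, 6, 16, 26, 36, 46, 50, 51, 52, 53, 54, 76, 5, 15, 25, 35, 45, 67, 65, 56]"
  by (simp add: vertex_list_eq reflect_def)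

lemmas reflect_rows = reflect_table[unfolded vertex_list_eq list.map list.inject simp_thms]

lemmas rows = straight_rows twisted_rows shift_rows dilate_rows invert_rows reverse_rows reflect_rows

text \<open>With these rules alone a bounded statement about the tables is decided by rewriting on binary
  numerals. The general simplification rules are kept away since they would turn \<open>1\<close> into \<open>Suc 0\<close>,
  to which no row applies. Where a filter is evaluated, the congruence rule \<open>if_weak_cong\<close> delays the
  branches of a conditional until its condition is decided; otherwise both would be expanded.\<close>

lemmas evaluate = vertex_list_eq list.map append.simps concat.simps ball_simps(5,7) bex_simps(5,7)
  distinct.simps list.set insert_iff empty_iff removeAll.simps prod.case
  numeral_eq_iff num.distinct num.inject one_eq_numeral_iff numeral_eq_one_iff
  if_True if_False simp_thms

section \<open>Graphs given by adjacency lists\<close>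

definition ball_list :: "(nat \<Rightarrow> nat list) \<Rightarrow> nat \<Rightarrow> nat list" where
  "ball_list nb u = u # nb u @ concat (map nb (nb u))"

definition far_list :: "(nat \<Rightarrow> nat list) \<Rightarrow> nat \<Rightarrow> nat list" where
  "far_list nb u = filter (\<lambda>x. x \<notin> set (ball_list nb u)) vertex_list"

text \<open>If \<open>R\<close> is the complement of the ball of radius 2 about \<open>u\<close>, then an antipode of \<open>u\<close> is a member of \<open>R\<close>
  all of whose neighbours lie in \<open>R\<close>.\<close>

definition star_free :: "(nat \<Rightarrow> nat list) \<Rightarrow> nat list \<Rightarrow> bool" where
  "star_free nb R \<longleftrightarrow> (\<forall>w\<in>set R. \<exists>x\<in>set (nb w). x \<notin> set R)"

text \<open>A walk in the Schreier graph of the generators \<open>gs\<close>: it stays in one orbit.\<close>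

primrec schreier_walk :: "('a \<Rightarrow> 'a) list \<Rightarrow> 'a \<Rightarrow> 'a list \<Rightarrow> bool" where
  "schreier_walk gs x [] \<longleftrightarrow> True"
| "schreier_walk gs x (y # ys) \<longleftrightarrow> (\<exists>g\<in>set gs. g x = y) \<and> schreier_walk gs y ys"

text \<open>A certificate that an automorphism fixing \<open>F\<close> pointwise is the identity: each step names a vertex
  \<open>w\<close> and two of its neighbours that are already known to be fixed.\<close>

primrec forced :: "(nat \<Rightarrow> nat list) \<Rightarrow> nat list \<Rightarrow> (nat \<times> nat \<times> nat) list \<Rightarrow> bool" where
  "forced nb F [] \<longleftrightarrow> (\<forall>v\<in>set vertex_list. v \<in> set F)"
| "forced nb F (c # cs) \<longleftrightarrow> (case c of (w, u, v) \<Rightarrow>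
     u \<in> set F \<and> v \<in> set F \<and> u \<noteq> v \<and> w \<in> set vertex_list \<and> u \<in> set (nb w) \<and> v \<in> set (nb w) \<and>
     forced nb (w # F) cs)"

lemma distinct_concat_mapD:
  "distinct (concat (map g xs)) \<Longrightarrow> x \<in> set xs \<Longrightarrow> y \<in> set xs \<Longrightarrow> z \<in> set (g x) \<Longrightarrow> z \<in> set (g y) \<Longrightarrow> x = y"
  by (induction xs) auto

lemma distinct_vertex_list: "distinct vertex_list"
  by (simp only: evaluate)

lemma card_vertex_list: "card (set vertex_list) = 44"
  using distinct_card[OF distinct_vertex_list] by (simp add: vertex_list_eq)

text \<open>The last assumption lists the breadth-first tree of depth 2 at every vertex and requires its nodes
  to be distinct, which excludes loops, triangles and 4-cycles at once.\<close>

locale adjacency_lists =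
  fixes nb :: "nat \<Rightarrow> nat list"
  assumes length_nb: "\<forall>u\<in>set vertex_list. length (nb u) = 6"
    and sym_nb: "\<forall>u\<in>set vertex_list. \<forall>v\<in>set (nb u). v \<in> set vertex_list \<and> u \<in> set (nb v)"
    and tree_nb: "\<forall>u\<in>set vertex_list. distinct (u # nb u @ concat (map (\<lambda>v. removeAll u (nb v)) (nb u)))"
begin

abbreviation "G \<equiv> list_graph nb"

lemma nb_closed: "u \<in> set vertex_list \<Longrightarrow> v \<in> set (nb u) \<Longrightarrow> v \<in> set vertex_list"
  and nb_sym: "u \<in> set vertex_list \<Longrightarrow> v \<in> set (nb u) \<Longrightarrow> u \<in> set (nb v)"
  using sym_nb by blast+

lemma square_free:
  assumes "u \<in> set vertex_list" "x \<in> set (nb u)" "v \<in> set (nb x)" "y \<in> set (nb u)" "v \<in> set (nb y)" "u \<noteq> v"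
  shows "x = y"
proof (rule distinct_concat_mapD)
  show "distinct (concat (map (\<lambda>v. removeAll u (nb v)) (nb u)))"
    using tree_nb assms(1) by (simp only: distinct.simps distinct_append)
qed (use assms in auto)

lemma triangle_free:
  assumes "u \<in> set vertex_list" "v \<in> set (nb u)" "w \<in> set (nb v)" "w \<in> set (nb u)"
  shows False
proof -
  have d: "distinct (u # nb u @ concat (map (\<lambda>v. removeAll u (nb v)) (nb u)))"
    using tree_nb assms(1) by blast
  then have "w \<noteq> u" using assms by auto
  then have "w \<in> set (concat (map (\<lambda>v. removeAll u (nb v)) (nb u)))" using assms by auto
  then show False using d assms(4) by auto
qed

lemma card_nb: "u \<in> set vertex_list \<Longrightarrow> card (set (nb u)) = 6"
  using tree_nb length_nb by (metis distinct.simps(2) distinct_append distinct_card)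

lemma girth5: "girth5_graph G 6"
proof
  fix e assume e: "e \<in> parcs G"
  then obtain u v where uv: "e = (u, v)" "u \<in> set vertex_list" "v \<in> set (nb u)" by (cases e) simp
  then show "fst e \<in> pverts G" "snd e \<in> pverts G" using nb_closed[of u v] by auto
  have "u \<notin> set (nb u)" using tree_nb uv(2) by force
  then show "fst e \<noteq> snd e" using uv by auto
next
  show "symmetric G"
    unfolding symmetric_def with_proj_simps by (intro symI) (simp, blast intro: nb_closed nb_sym)
  show "finite (pverts G)" by simp
  have "parcs G \<subseteq> set vertex_list \<times> set vertex_list" by (auto simp: list_graph_def intro: nb_closed)
  then show "finite (parcs G)" by (rule finite_subset) simp
  show "card (pverts G) = 6\<^sup>2 + 6 + 2" by (simp add: card_vertex_list)
  show "card (nbhd G u) = 6" if "u \<in> pverts G" for u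
    using that card_nb by simp
  show "(w, u) \<notin> parcs G" if "(u, v) \<in> parcs G" "(v, w) \<in> parcs G" for u v w
    using that triangle_free[of u v w] nb_sym[of w u] by auto
  show "x = y" if "(u, x) \<in> parcs G" "(x, v) \<in> parcs G" "(u, y) \<in> parcs G" "(y, v) \<in> parcs G" "u \<noteq> v"
    for u v x y
    using that square_free[of u x v y] by simp
qed simp

sublocale girth5_graph G 6 by (rule girth5)

lemma near_list_iff: "u \<in> set vertex_list \<Longrightarrow> near G u v \<longleftrightarrow> v \<in> set (ball_list nb u)"
  by (auto simp: near_def ball_list_def intro: nb_closed)

lemma antipodalI:
  assumes "u \<in> set vertex_list" "w \<in> set vertex_list" "\<forall>x\<in>set (w # nb w). x \<notin> set (ball_list nb u)"
  shows "antipodal G u w"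
  using assms near_list_iff by (simp add: antipodal_def)

lemma antipodal_in:
  assumes "\<forall>u\<in>set vertex_list. u \<in> Z \<or> star_free nb (far_list nb u)" "antipodal G u w"
  shows "u \<in> Z"
proof (rule ccontr)
  have u: "u \<in> set vertex_list" and w: "w \<in> set vertex_list" using assms(2) by (auto simp: antipodal_def)
  have far: "x \<in> set (far_list nb u) \<longleftrightarrow> x \<in> set vertex_list \<and> \<not> near G u x" for x
    by (auto simp: far_list_def near_list_iff[OF u])
  assume "u \<notin> Z"
  moreover have "w \<in> set (far_list nb u)" using assms(2) far w by (simp add: antipodal_def)
  ultimately obtain x where "x \<in> set (nb w)" "x \<notin> set (far_list nb u)"
    using assms(1) u unfolding star_free_def by blast
  with assms(2) w far nb_closed[OF w] show False
    by (auto simp: antipodal_def)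
qed

text \<open>Since all neighbourhoods have six elements, it suffices that an injective map sends arcs to arcs.\<close>

lemma automorphismI:
  assumes "\<forall>u\<in>set vertex_list. f u \<in> set vertex_list" "distinct (map f vertex_list)"
    and "\<forall>u\<in>set vertex_list. \<forall>v\<in>set (nb u). f v \<in> set (nb (f u))"
  shows "restrict f (set vertex_list) \<in> graph_automorphisms G"
proof -
  have inj: "inj_on f (set vertex_list)" using assms(2) by (simp add: distinct_map)
  have "f ` set vertex_list = set vertex_list"
    using assms(1) inj by (intro endo_inj_surj) auto
  with inj have bij: "bij_betw f (set vertex_list) (set vertex_list)" by (simp add: bij_betw_def)
  have img: "f ` set (nb u) = set (nb (f u))" if u: "u \<in> set vertex_list" for u
  proof (rule card_subset_eq)
    have "inj_on f (set (nb u))" using nb_closed[OF u] by (intro inj_on_subset[OF inj]) blast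
    then show "card (f ` set (nb u)) = card (set (nb (f u)))"
      using card_nb u assms(1) by (simp add: card_image)
  qed (use assms(3) u in auto)
  have "f v \<in> set (nb (f u)) \<longleftrightarrow> v \<in> set (nb u)" if "u \<in> set vertex_list" "v \<in> set vertex_list" for u v
    using inj_on_image_mem_iff[OF inj that(2), of "set (nb u)"] img[OF that(1)] nb_closed[OF that(1)] by blast
  then show ?thesis
    using bij assms(1) by (auto simp: graph_automorphisms_def Bij_def bij_betw_restrict_eq)
qed

lemma orbit_walk:
  assumes gs: "\<forall>g\<in>set gs. restrict g (set vertex_list) \<in> graph_automorphisms G \<and> (\<forall>b\<in>B. g b = b)"
    and B: "B \<subseteq> set vertex_list" and x: "x \<in> set vertex_list" and walk: "schreier_walk gs x ys"
  shows "set (x # ys) \<subseteq> (\<lambda>f. f x) ` pointwise_stabilizer G B"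
proof -
  let ?O = "(\<lambda>f. f x) ` pointwise_stabilizer G B"
  have "?O \<subseteq> set vertex_list"
    using x by (auto simp: pointwise_stabilizer_def dest: bij_betw_apply[OF automorphismD(1)])
  moreover have "restrict g (set vertex_list) \<in> pointwise_stabilizer G B" if "g \<in> set gs" for g
    using gs B that by (auto simp: pointwise_stabilizer_def)
  ultimately have step: "g y \<in> ?O" if "g \<in> set gs" "y \<in> ?O" for g y
    using orbit_step[of "restrict g (set vertex_list)" G B x y] B x that by auto
  have "set ys \<subseteq> ?O" if "schreier_walk gs y ys" "y \<in> ?O" for y
    using that
  proof (induction ys arbitrary: y)
    case (Cons z zs)
    then have z: "z \<in> ?O" using step by auto
    have "set zs \<subseteq> ?O" by (rule Cons.IH[OF _ z]) (use Cons.prems in simp)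
    with z show ?case by simp
  qed simp
  moreover have "x \<in> ?O" using base_in_orbit[of B G x] B x by simp
  ultimately show ?thesis using walk by simp
qed

lemma card_stabilizer_step:
  assumes "\<forall>g\<in>set gs. restrict g (set vertex_list) \<in> graph_automorphisms G \<and> (\<forall>b\<in>B. g b = b)"
    and "B \<subseteq> set vertex_list" "x \<in> set vertex_list" "schreier_walk gs x ys"
    and "\<And>f. f \<in> pointwise_stabilizer G B \<Longrightarrow> f x \<in> set (x # ys)"
  shows "card (pointwise_stabilizer G B) = card (set (x # ys)) * card (pointwise_stabilizer G (insert x B))"
proof -
  have "(\<lambda>f. f x) ` pointwise_stabilizer G B = set (x # ys)"
    using orbit_walk[OF assms(1-4)] assms(5) by blast
  then show ?thesis
    using orbit_stabilizer[of G x B] assms(2,3) by simp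
qed

lemma automorphism_nbhd:
  assumes f: "f \<in> graph_automorphisms G" and u: "u \<in> set vertex_list"
  shows "set (nb (f u)) = f ` set (nb u)"
proof -
  have "f ` set (nb u) \<subseteq> set (nb (f u))"
    using automorphismD(3)[OF f] u nb_closed[OF u] by auto
  moreover have "inj_on f (set (nb u))"
    using nb_closed[OF u]
    by (intro inj_on_subset[OF bij_betw_imp_inj_on[OF automorphismD(1)[OF f]]]) auto
  moreover have "f u \<in> set vertex_list" using bij_betw_apply[OF automorphismD(1)[OF f]] u by simp
  ultimately show ?thesis
    using card_nb u by (metis List.finite_set card_image card_subset_eq)
qed

lemma stabilizer_nbhd:
  assumes f: "f \<in> pointwise_stabilizer G B" and "B \<subseteq> set vertex_list" "z \<in> B" "x \<in> set (nb z)" "x \<notin> B"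
  shows "f x \<in> set (nb z) - B"
proof -
  have fa: "f \<in> graph_automorphisms G" and fz: "f z = z" using f assms(3) by (auto simp: pointwise_stabilizer_def)
  have z: "z \<in> set vertex_list" and x: "x \<in> set vertex_list" using assms(2-4) nb_closed by blast+
  have "f x \<in> set (nb z)" using automorphism_nbhd[OF fa z] fz assms(4) by auto
  moreover have "f x \<noteq> f b" "f b = b" if "b \<in> B" for b
    using inj_onD[OF bij_betw_imp_inj_on[OF automorphismD(1)[OF fa]], of x b] x assms(2,5) that f
    by (auto simp: pointwise_stabilizer_def)
  ultimately show ?thesis by force
qed

lemma forced_fixes:
  assumes f: "f \<in> graph_automorphisms G"
  shows "forced nb F cs \<Longrightarrow> \<forall>u\<in>set F. f u = u \<Longrightarrow> v \<in> set vertex_list \<Longrightarrow> f v = v"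
proof (induction cs arbitrary: F)
  case Nil
  then have "v \<in> set F" by simp
  with Nil(2) show ?case by blast
next
  case (Cons c cs)
  obtain w u v' where c: "c = (w, u, v')" by (cases c)
  with Cons.prems(1) have chk: "u \<in> set F" "v' \<in> set F" "u \<noteq> v'" "w \<in> set vertex_list"
      "u \<in> set (nb w)" "v' \<in> set (nb w)" and rest: "forced nb (w # F) cs"
    by simp_all
  have "f u = u" "f v' = v'" using Cons.prems(2) chk(1,2) by blast+
  then have "f w = w"
    by (rule fixes_common_neighbour[OF f _ _ chk(3)]) (use chk(4-6) in simp_all)
  with Cons.prems(2) have "\<forall>u\<in>set (w # F). f u = u" by simp
  then show ?case by (rule Cons.IH[OF rest _ Cons.prems(3)])
qed

lemma automorphism_antipodal:
  assumes f: "f \<in> graph_automorphisms G" and "antipodal G u w"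
  shows "antipodal G (f u) (f w)"
  using antipodal_iso_iff[OF pair_wf_digraph_axioms pair_wf_digraph_axioms automorphismD(1,3)[OF f]] assms(2)
  by (auto simp: antipodal_def)

end

text \<open>An isomorphism invariant of the arc from \<open>z\<close> to \<open>z'\<close>: a 6-cycle through it in which the two
  neighbours \<open>a\<close> of \<open>z\<close> and \<open>d\<close> of \<open>z'\<close> have no common neighbour. In the graph with midpoints it
  tells the arc between \<open>56\<close> and \<open>76\<close> from the one between \<open>65\<close> and \<open>67\<close>.\<close>

definition hexagon :: "'a pair_pre_digraph \<Rightarrow> 'a \<Rightarrow> 'a \<Rightarrow> bool" where
  "hexagon G z z' \<longleftrightarrow> (\<exists>a b c d. (z, a) \<in> parcs G \<and> (a, b) \<in> parcs G \<and> (b, c) \<in> parcs G \<and>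
     (c, d) \<in> parcs G \<and> (z', d) \<in> parcs G \<and> a \<noteq> z' \<and> b \<noteq> z \<and> c \<noteq> z' \<and> d \<noteq> z \<and>
     \<not> (\<exists>e. (a, e) \<in> parcs G \<and> (e, d) \<in> parcs G))"

lemma (in adjacency_lists) automorphism_hexagon:
  assumes f: "f \<in> graph_automorphisms G" and u: "u \<in> set vertex_list" "v \<in> set vertex_list" and hex: "hexagon G u v"
  shows "hexagon G (f u) (f v)"
proof -
  obtain a b c d where p: "(u, a) \<in> parcs G" "(a, b) \<in> parcs G" "(b, c) \<in> parcs G"
      "(c, d) \<in> parcs G" "(v, d) \<in> parcs G" "a \<noteq> v" "b \<noteq> u" "c \<noteq> v" "d \<noteq> u"
      and no: "\<not> (\<exists>e. (a, e) \<in> parcs G \<and> (e, d) \<in> parcs G)"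
    using hex unfolding hexagon_def by blast
  then have V: "a \<in> set vertex_list" "b \<in> set vertex_list" "c \<in> set vertex_list" "d \<in> set vertex_list"
    using nb_closed by auto
  have V': "f x \<in> set vertex_list" if "x \<in> set vertex_list" for x
    using bij_betw_apply[OF automorphismD(1)[OF f]] that by simp
  have nb: "f y \<in> set (nb (f x))" if "(x, y) \<in> parcs G" for x y
    using automorphism_nbhd[OF f, of x] that by simp
  have inj: "f x = f y \<longleftrightarrow> x = y" if "x \<in> set vertex_list" "y \<in> set vertex_list" for x y
    using bij_betw_imp_inj_on[OF automorphismD(1)[OF f]] that by (simp add: inj_on_eq_iff)
  have "\<not> (\<exists>e. (f a, e) \<in> parcs G \<and> (e, f d) \<in> parcs G)"
  proof
    assume "\<exists>e. (f a, e) \<in> parcs G \<and> (e, f d) \<in> parcs G"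
    then obtain e where e: "e \<in> set (nb (f a))" "(e, f d) \<in> parcs G" by auto
    then obtain e' where e': "e = f e'" "e' \<in> set (nb a)"
      using automorphism_nbhd[OF f V(1)] by blast
    then have "(e', d) \<in> parcs G"
      using automorphismD(3)[OF f] e(2) V nb_closed[OF V(1)] by auto
    with e'(2) V(1) no show False by auto
  qed
  then show ?thesis
    using p nb V V' u inj unfolding hexagon_def parcs_list_graph by metis
qed

section \<open>Antipodes and automorphisms of the two graphs\<close>

interpretation straight: adjacency_lists straight
proof
  show "\<forall>u\<in>set vertex_list. length (straight u) = 6"
    by (simp add: evaluate rows del: One_nat_def)
qed (simp_all only: evaluate rows)

interpretation twisted: adjacency_lists twisted
proof
  show "\<forall>u\<in>set vertex_list. length (twisted u) = 6"
    by (simp add: evaluate rows del: One_nat_def)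
qed (simp_all only: evaluate rows)

definition straight_antipodes :: "(nat \<times> nat) list" where
  "straight_antipodes = [(6, 60), (16, 61), (26, 62), (36, 63), (46, 64), (56, 65), (76, 67),
     (60, 6), (61, 16), (62, 26), (63, 36), (64, 46), (65, 56), (67, 76)]"

definition twisted_antipodes :: "(nat \<times> nat) list" where
  "twisted_antipodes = [(56, 65), (76, 67), (65, 56), (67, 76)]"

lemma straight_antipodal:
  "(u, w) \<in> set straight_antipodes \<Longrightarrow> antipodal (list_graph straight) u w"
proof -
  have "\<forall>(u, w)\<in>set straight_antipodes. u \<in> set vertex_list \<and> w \<in> set vertex_list \<and>
      (\<forall>x\<in>set (w # straight w). x \<notin> set (ball_list straight u))"
    by (simp only: evaluate rows straight_antipodes_def ball_list_def)
  then show "(u, w) \<in> set straight_antipodes \<Longrightarrow> ?thesis"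
    by (intro straight.antipodalI) auto
qed

lemma straight_antipodal_in:
  "antipodal (list_graph straight) u w \<Longrightarrow> u \<in> {6, 16, 26, 36, 46, 56, 60, 61, 62, 63, 64, 65, 67, 76}"
  by (rule straight.antipodal_in) (simp_all only: evaluate rows star_free_def far_list_def ball_list_def
      filter.simps cong: if_weak_cong)

lemma twisted_antipodal:
  "(u, w) \<in> set twisted_antipodes \<Longrightarrow> antipodal (list_graph twisted) u w"
proof -
  have "\<forall>(u, w)\<in>set twisted_antipodes. u \<in> set vertex_list \<and> w \<in> set vertex_list \<and>
      (\<forall>x\<in>set (w # twisted w). x \<notin> set (ball_list twisted u))"
    by (simp only: evaluate rows twisted_antipodes_def ball_list_def)
  then show "(u, w) \<in> set twisted_antipodes \<Longrightarrow> ?thesis"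
    by (intro twisted.antipodalI) auto
qed

lemma twisted_antipodal_in:
  "antipodal (list_graph twisted) u w \<Longrightarrow> u \<in> {56, 65, 67, 76}"
  by (rule twisted.antipodal_in) (simp_all only: evaluate rows star_free_def far_list_def ball_list_def
      filter.simps cong: if_weak_cong)

lemma straight_automorphisms:
  "restrict shift (set vertex_list) \<in> graph_automorphisms (list_graph straight)"
  "restrict dilate (set vertex_list) \<in> graph_automorphisms (list_graph straight)"
  "restrict invert (set vertex_list) \<in> graph_automorphisms (list_graph straight)"
  "restrict reverse (set vertex_list) \<in> graph_automorphisms (list_graph straight)"
  by (rule straight.automorphismI; simp only: evaluate rows)+

lemma twisted_automorphisms:
  "restrict shift (set vertex_list) \<in> graph_automorphisms (list_graph twisted)"
  "restrict dilate (set vertex_list) \<in> graph_automorphisms (list_graph twisted)"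
  "restrict reflect (set vertex_list) \<in> graph_automorphisms (list_graph twisted)"
  by (rule twisted.automorphismI; simp only: evaluate rows)+

section \<open>The orders of the automorphism groups\<close>

text \<open>The steps extend the fixed base points and their antipodes to all vertices. They were obtained by
  closing that set under common neighbours.\<close>

definition straight_steps :: "(nat \<times> nat \<times> nat) list" where
  "straight_steps =
   [(1, 6, 61), (5, 6, 65), (10, 16, 60), (12, 16, 5), (15, 16, 65), (23, 1, 15), (25, 65, 10),
   (30, 60, 15), (31, 61, 5), (34, 1, 12), (40, 60, 12), (41, 61, 25), (42, 15, 31),
   (43, 5, 10), (45, 65, 1), (50, 56, 60), (51, 56, 61), (52, 56, 1), (53, 56, 12),
   (54, 56, 10), (26, 76, 23), (36, 76, 30), (46, 76, 40), (62, 67, 12), (63, 67, 23),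
   (64, 67, 34), (2, 6, 41), (3, 6, 25), (4, 6, 15), (13, 16, 45), (14, 16, 52), (20, 60, 31),
   (21, 61, 43), (24, 5, 30), (32, 10, 45), (35, 65, 40)]"

definition twisted_steps :: "(nat \<times> nat \<times> nat) list" where
  "twisted_steps =
   [(60, 50, 67), (61, 51, 67), (32, 51, 60), (34, 50, 61), (45, 65, 32), (36, 76, 32),
   (46, 76, 45), (1, 34, 45), (13, 50, 45), (20, 61, 45), (23, 60, 1), (24, 51, 13),
   (25, 65, 34), (30, 36, 24), (31, 36, 20), (35, 65, 36), (40, 51, 46), (41, 60, 46),
   (42, 50, 46), (43, 61, 46), (52, 56, 1), (53, 56, 20), (54, 56, 23), (6, 76, 1),
   (16, 76, 13), (26, 76, 20), (62, 67, 13), (63, 67, 1), (64, 67, 30), (2, 61, 13),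
   (3, 51, 25), (4, 32, 53), (5, 65, 24), (10, 32, 25), (12, 34, 40), (14, 60, 20),
   (15, 65, 23), (21, 50, 35)]"

lemma straight_base_fixed:
  assumes f: "f \<in> pointwise_stabilizer (list_graph straight) {16, 6, 56, 76}" and v: "v \<in> set vertex_list"
  shows "f v = v"
proof -
  have fa: "f \<in> graph_automorphisms (list_graph straight)"
    and base: "f 16 = 16" "f 6 = 6" "f 56 = 56" "f 76 = 76" using f by (auto simp: pointwise_stabilizer_def)
  note antipode = straight.fixes_antipode[OF fa straight_antipodal]
  have "f 67 = 67" "f 65 = 65" "f 60 = 60" "f 61 = 61"
    using antipode[of 76 67] antipode[of 56 65] antipode[of 6 60] antipode[of 16 61] base
    by (simp_all add: straight_antipodes_def)
  with base have "\<forall>u\<in>set [76, 56, 6, 16, 67, 65, 60, 61]. f u = u" by simp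
  moreover have "forced straight [76, 56, 6, 16, 67, 65, 60, 61] straight_steps"
    by (simp only: straight_steps_def forced.simps evaluate rows)
  ultimately show ?thesis using straight.forced_fixes[OF fa] v by blast
qed

text \<open>The vertices that have an antipode are the two centres and their neighbours. Only the centres have
  all their neighbours among them.\<close>

lemma straight_root:
  assumes f: "f \<in> graph_automorphisms (list_graph straight)"
  shows "f 76 \<in> {76, 67}"
proof -
  have fv: "f 76 \<in> set vertex_list"
    using bij_betw_apply[OF automorphismD(1)[OF f], of 76] by (simp add: vertex_list_eq)
  have "x \<in> {6, 16, 26, 36, 46, 56, 60, 61, 62, 63, 64, 65, 67, 76}" if x: "x \<in> set (straight (f 76))" for x
  proof -
    have "straight 76 = [6, 16, 26, 36, 46, 56]" by (simp only: rows)
    then obtain y where y: "x = f y" "y \<in> set [6, 16, 26, 36, 46, 56]"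
      using x straight.automorphism_nbhd[OF f, of 76] by (auto simp: vertex_list_eq)
    then obtain w where "(y, w) \<in> set straight_antipodes" by (auto simp: straight_antipodes_def)
    then have "antipodal (list_graph straight) x (f w)"
      unfolding y(1) by (intro straight.automorphism_antipodal[OF f] straight_antipodal)
    then show ?thesis by (rule straight_antipodal_in)
  qed
  moreover have "\<forall>u\<in>set vertex_list. u \<in> {76, 67} \<or>
      (\<exists>x\<in>set (straight u). x \<notin> {6, 16, 26, 36, 46, 56, 60, 61, 62, 63, 64, 65, 67, 76})"
    by (simp only: evaluate rows)
  ultimately show ?thesis using fv by blast
qed

text \<open>The base is \<open>76, 56, 6, 16\<close>. Fixing the centre \<open>76\<close> leaves the projective group acting on the
  vertices \<open>i6\<close>, hence on the points, and it is sharply 3-transitive there: the orbit sizes are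
  \<open>2, 6, 5, 4\<close>. Each upper bound is trivial, because the next base point has to stay a neighbour of
  \<open>76\<close> that is not yet used.\<close>

lemma order_straight: "order (graph_aut_group (list_graph straight)) = 240"
proof -
  let ?S = "pointwise_stabilizer (list_graph straight)"
  have V: "{6, 16, 56, 76} \<subseteq> set vertex_list" by (simp add: vertex_list_eq)
  have "card (?S {}) = card (set [76, 67 :: nat]) * card (?S {76})"
    using straight_automorphisms V straight_root
    by (intro straight.card_stabilizer_step[where gs = "[reverse]"])
      (auto simp: pointwise_stabilizer_def rows)
  moreover have "card (?S {76}) = card (set [56, 6, 16, 26, 36, 46 :: nat]) * card (?S {56, 76})"
  proof (intro straight.card_stabilizer_step[where gs = "[invert, shift]"])
    show "f 56 \<in> set [56, 6, 16, 26, 36, 46]" if "f \<in> ?S {76}" for f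
      using straight.stabilizer_nbhd[OF that, of 76 56] V by (auto simp: rows)
  qed (use straight_automorphisms V in \<open>auto simp: rows\<close>)
  moreover have "card (?S {56, 76}) = card (set [6, 16, 26, 36, 46 :: nat]) * card (?S {6, 56, 76})"
  proof (intro straight.card_stabilizer_step[where gs = "[shift]"])
    show "f 6 \<in> set [6, 16, 26, 36, 46]" if "f \<in> ?S {56, 76}" for f
      using straight.stabilizer_nbhd[OF that, of 76 6] V by (auto simp: rows)
  qed (use straight_automorphisms V in \<open>auto simp: rows\<close>)
  moreover have "card (?S {6, 56, 76}) = card (set [16, 26, 46, 36 :: nat]) * card (?S {16, 6, 56, 76})"
  proof (intro straight.card_stabilizer_step[where gs = "[dilate]"])
    show "f 16 \<in> set [16, 26, 46, 36]" if "f \<in> ?S {6, 56, 76}" for f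
      using straight.stabilizer_nbhd[OF that, of 76 16] V by (auto simp: rows)
  qed (use straight_automorphisms V in \<open>auto simp: rows\<close>)
  moreover have "card (?S {16, 6, 56, 76}) = 1"
    using V straight_base_fixed by (intro card_stabilizer_whole) auto
  ultimately show ?thesis by (simp add: order_graph_aut_group)
qed

lemma twisted_antipodal_nbhd:
  assumes f: "f \<in> graph_automorphisms (list_graph twisted)" and "u \<in> {56, 65, 67, 76}"
  shows "f u \<in> {56, 65, 67, 76}"
proof -
  obtain w where "(u, w) \<in> set twisted_antipodes"
    using assms(2) by (auto simp: twisted_antipodes_def)
  then show ?thesis
    by (intro twisted_antipodal_in[of "f u" "f w"] twisted.automorphism_antipodal[OF f] twisted_antipodal)
qed

lemma hexagon_twisted:
  "hexagon (list_graph twisted) 56 76" "\<not> hexagon (list_graph twisted) 65 67" "\<not> hexagon (list_graph twisted) 67 65"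
proof -
  have "\<forall>e\<in>set (twisted 50). 6 \<notin> set (twisted e)"
    by (simp only: evaluate rows)
  then show "hexagon (list_graph twisted) 56 76"
    unfolding hexagon_def parcs_list_graph
    by (intro exI[of _ 50] exI[of _ 13] exI[of _ 2] exI[of _ 6]) (auto simp: vertex_list_eq rows)
  have "\<forall>(z, z')\<in>set [(65, 67), (67, 65)]. \<forall>a\<in>set (twisted z). \<forall>d\<in>set (twisted z').
      a = z' \<or> d = z \<or> (\<exists>e\<in>set (twisted a). d \<in> set (twisted e)) \<or>
      (\<forall>b\<in>set (twisted a). b = z \<or> (\<forall>c\<in>set (twisted b). c = z' \<or> d \<notin> set (twisted c)))"
    by (simp only: evaluate rows)
  then have *: "a = z' \<or> d = z \<or> (\<exists>e\<in>set (twisted a). d \<in> set (twisted e)) \<or>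
      (\<forall>b\<in>set (twisted a). b = z \<or> (\<forall>c\<in>set (twisted b). c = z' \<or> d \<notin> set (twisted c)))"
    if "(z, z') \<in> set [(65, 67), (67, 65)]" "a \<in> set (twisted z)" "d \<in> set (twisted z')" for z z' a d
    using that by blast
  have "\<not> hexagon (list_graph twisted) z z'" if z: "(z, z') \<in> set [(65, 67), (67, 65)]" for z z'
  proof
    assume "hexagon (list_graph twisted) z z'"
    then obtain a b c d where p: "a \<in> set (twisted z)" "d \<in> set (twisted z')" "a \<noteq> z'" "d \<noteq> z"
        "b \<in> set (twisted a)" "b \<noteq> z" "c \<in> set (twisted b)" "c \<noteq> z'" "d \<in> set (twisted c)" "a \<in> set vertex_list"
        "\<not> (\<exists>e\<in>set (twisted a). e \<in> set vertex_list \<and> d \<in> set (twisted e))"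
      unfolding hexagon_def parcs_list_graph by blast
    then show False using *[OF z p(1,2)] twisted.nb_closed by blast
  qed
  then show "\<not> hexagon (list_graph twisted) 65 67" "\<not> hexagon (list_graph twisted) 67 65"
    by simp_all
qed

lemma twisted_root:
  assumes f: "f \<in> graph_automorphisms (list_graph twisted)"
  shows "f 56 \<in> {56, 76}" "f 56 = 56 \<Longrightarrow> f 76 = 76"
proof -
  have fv: "f 56 \<in> {56, 65, 67, 76}" "f 76 \<in> {56, 65, 67, 76}"
    using twisted_antipodal_nbhd[OF f] by blast+
  have "76 \<in> set (twisted 56)" by (simp only: evaluate rows)
  then have nb: "f 76 \<in> set (twisted (f 56))"
    using twisted.automorphism_nbhd[OF f, of 56] by (simp add: vertex_list_eq)
  have hex: "hexagon (list_graph twisted) (f 56) (f 76)"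
    by (rule twisted.automorphism_hexagon[OF f _ _ hexagon_twisted(1)]) (simp_all add: vertex_list_eq)
  show "f 56 \<in> {56, 76}"
    using fv nb hex hexagon_twisted(2,3) by (auto simp: rows)
  show "f 76 = 76" if "f 56 = 56"
    using fv nb unfolding that by (auto simp: rows)
qed

lemma twisted_base_fixed:
  assumes f: "f \<in> pointwise_stabilizer (list_graph twisted) {51, 50, 76, 56}" and v: "v \<in> set vertex_list"
  shows "f v = v"
proof -
  have fa: "f \<in> graph_automorphisms (list_graph twisted)"
    and base: "f 51 = 51" "f 50 = 50" "f 56 = 56" "f 76 = 76" using f by (auto simp: pointwise_stabilizer_def)
  note antipode = twisted.fixes_antipode[OF fa twisted_antipodal]
  have "f 65 = 65" "f 67 = 67"
    using antipode[of 56 65] antipode[of 76 67] base by (simp_all add: twisted_antipodes_def)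
  with base have "\<forall>u\<in>set [56, 76, 50, 51, 65, 67]. f u = u" by simp
  moreover have "forced twisted [56, 76, 50, 51, 65, 67] twisted_steps"
    by (simp only: twisted_steps_def forced.simps evaluate rows)
  ultimately show ?thesis using twisted.forced_fixes[OF fa] v by blast
qed

text \<open>The base is \<open>56, 50, 51\<close> with orbit sizes \<open>2, 5, 4\<close>: the stabilizer of \<open>56\<close> acts on its neighbours
  \<open>5j\<close> as the affine group on the finite points. The vertex \<open>76\<close> is fixed along with \<open>56\<close> as its only
  neighbour that has an antipode.\<close>

lemma order_twisted: "order (graph_aut_group (list_graph twisted)) = 40"
proof -
  let ?S = "pointwise_stabilizer (list_graph twisted)"
  have V: "{50, 51, 56, 76} \<subseteq> set vertex_list" by (simp add: vertex_list_eq)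
  have "card (?S {}) = card (set [56, 76 :: nat]) * card (?S {56})"
    using twisted_automorphisms V twisted_root(1)
    by (intro twisted.card_stabilizer_step[where gs = "[reflect]"])
      (auto simp: pointwise_stabilizer_def rows)
  moreover have "?S {56} = ?S {76, 56}"
    using twisted_root(2) by (auto simp: pointwise_stabilizer_def)
  moreover have "card (?S {76, 56}) = card (set [50, 51, 52, 53, 54 :: nat]) * card (?S {50, 76, 56})"
  proof (intro twisted.card_stabilizer_step[where gs = "[shift]"])
    show "f 50 \<in> set [50, 51, 52, 53, 54]" if "f \<in> ?S {76, 56}" for f
      using twisted.stabilizer_nbhd[OF that, of 56 50] V by (auto simp: rows)
  qed (use twisted_automorphisms V in \<open>auto simp: rows\<close>)
  moreover have "card (?S {50, 76, 56}) = card (set [51, 52, 54, 53 :: nat]) * card (?S {51, 50, 76, 56})"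
  proof (intro twisted.card_stabilizer_step[where gs = "[dilate]"])
    show "f 51 \<in> set [51, 52, 54, 53]" if "f \<in> ?S {50, 76, 56}" for f
      using twisted.stabilizer_nbhd[OF that, of 56 51] V by (auto simp: rows)
  qed (use twisted_automorphisms V in \<open>auto simp: rows\<close>)
  moreover have "card (?S {51, 50, 76, 56}) = 1"
    using V twisted_base_fixed by (intro card_stabilizer_whole) auto
  ultimately show ?thesis by (simp add: order_graph_aut_group)
qed

text \<open>An isomorphism would carry antipodal pairs to antipodal pairs, but \<open>4\<close> vertices have an antipode in
  one graph and \<open>14\<close> in the other.\<close>

lemma not_iso: "\<not> digraph_iso (with_proj (list_graph twisted)) (with_proj (list_graph straight))"
proof
  assume "digraph_iso (with_proj (list_graph twisted)) (with_proj (list_graph straight))"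
  then obtain f where bij: "bij_betw f (set vertex_list) (set vertex_list)"
    and arcs: "\<forall>u\<in>pverts (list_graph twisted). \<forall>v\<in>pverts (list_graph twisted).
      (f u, f v) \<in> parcs (list_graph straight) \<longleftrightarrow> (u, v) \<in> parcs (list_graph twisted)"
    using digraph_iso_pair_iff[OF twisted.pair_wf_digraph_axioms straight.pair_wf_digraph_axioms]
    by auto
  have "fst ` set straight_antipodes \<subseteq> f ` {56, 65, 67, 76}"
  proof
    fix u assume "u \<in> fst ` set straight_antipodes"
    then obtain w where "(u, w) \<in> set straight_antipodes" by force
    then have a: "antipodal (list_graph straight) u w" by (rule straight_antipodal)
    then have "u \<in> f ` set vertex_list" "w \<in> f ` set vertex_list"
      using bij_betw_imp_surj_on[OF bij] by (simp_all add: antipodal_def)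
    then obtain x y where xy: "u = f x" "w = f y" "x \<in> set vertex_list" "y \<in> set vertex_list"
      by blast
    with a have "antipodal (list_graph twisted) x y"
      using antipodal_iso_iff[OF twisted.pair_wf_digraph_axioms straight.pair_wf_digraph_axioms _ arcs] bij
      by simp
    with xy(1) twisted_antipodal_in show "u \<in> f ` {56, 65, 67, 76}" by blast
  qed
  then have "card (fst ` set straight_antipodes) \<le> card (f ` {56, 65, 67, 76})"
    by (intro card_mono) auto
  also have "\<dots> \<le> card {56, 65, 67, 76 :: nat}" by (intro card_image_le) simp
  finally show False by (simp add: straight_antipodes_def)
qed

lemma girth_list: "girth (list_graph straight) = 5" "girth (list_graph twisted) = 5"
proof -
  show "girth (list_graph straight) = 5"
    by (rule straight.girth_eq_5[of 1 23 15 30 52]) (simp_all add: vertex_list_eq rows del: One_nat_def)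
  show "girth (list_graph twisted) = 5"
    by (rule twisted.girth_eq_5[of 1 23 15 30 52]) (simp_all add: vertex_list_eq rows del: One_nat_def)
qed

theorem mainTheorem5:
  shows "\<exists>(G :: nat pair_pre_digraph) (H :: nat pair_pre_digraph).
    pair_graph G \<and> regular_graph 6 G \<and> girth G = 5 \<and> diameter G = 4 \<and>
      card (pverts G) = 44 \<and> order (graph_aut_group G) = 40 \<and>
    pair_graph H \<and> regular_graph 6 H \<and> girth H = 5 \<and> diameter H = 4 \<and>
      card (pverts H) = 44 \<and> order (graph_aut_group H) = 240 \<and>
    \<not> digraph_iso (with_proj G) (with_proj H)"
proof (intro exI conjI)
  have "antipodal (list_graph straight) 76 67" "antipodal (list_graph twisted) 76 67"
    by (simp_all add: straight_antipodal twisted_antipodal straight_antipodes_def twisted_antipodes_def)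
  then show "diameter (list_graph twisted) = 4" "diameter (list_graph straight) = 4"
    by (simp_all only: straight.diameter_eq_4 twisted.diameter_eq_4)
qed (use straight.pair_graph_axioms twisted.pair_graph_axioms straight.regular twisted.regular
    girth_list order_straight order_twisted not_iso card_vertex_list in simp_all)

end
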